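(* Let $p$ and $\ell$ be odd prime numbers, and let $N\ge0$ be an integer such that $\ell\equiv1\pmod{p^{N+1}}$ and $\ell\not\equiv1\pmod{p^{N+2}}$. Then for all sufficiently large integers $n\ge N$, there exists an element $z\in\mathbb F_{\ell^{p^{n-N}}}^\times$ of order $p^{n+1}$ such that the order of $1-z\in\mathbb F_{\ell^{p^{n-N}}}^\times$ is divisible by $p$, i.e., $$(1-z)^{\frac{\ell^{p^{n-N}}-1}{p^{n+1}}}\neq1.$$
   Context: $\mathbb F_{\ell^m}$ denotes the finite field of cardinality $\ell^m$ and $\mathbb F_{\ell^m}^\times$ its multiplicative group. *)

theory Defs
  imports "HOL-Number_Theory.Number_Theory"
begin

(* The field with q elements is unique up to isomorphism, so a claim about it is
   stated for every field K with q elements.  When q varies inside a formula, K is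
   taken with carrier a set of naturals: every finite field has an isomorphic copy
   of this kind, and a bound quantified before K is then the same for all of them. *)
definition finite_field_of_card :: "('a, 'b) ring_scheme \<Rightarrow> nat \<Rightarrow> bool" where
  "finite_field_of_card K q \<longleftrightarrow> field K \<and> finite (carrier K) \<and> card (carrier K) = q"

end

theory Submission
  imports Defs
begin

text \<open>
  The idea is that \<open>1 - z = - z (1 - z\<inverse>)\<close>, so a suitable element can be found among
  \<open>z\<close> and \<open>z\<inverse>\<close> for every \<open>z\<close> of order \<open>p ^ (n + 1)\<close>. Write \<open>q = l ^ p ^ (n - N)\<close> and
  \<open>M = (q - 1) / p ^ (n + 1)\<close>. If \<open>1 - z\<close> and \<open>1 - z\<inverse>\<close> both had \<open>M\<close>-th power \<open>1\<close>, then so would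
  their quotient \<open>- z\<close>, whence \<open>z ^ (2 * M) = 1\<close>
  (\<open>pow_eq_one_of_one_minus_and_one_minus_inv\<close>) and \<open>p ^ (n + 1)\<close> would divide \<open>2 * M\<close>. This is
  impossible because \<open>p\<close> is odd and does not divide \<open>M\<close>.

  That \<open>M\<close> is an integer prime to \<open>p\<close> says that \<open>p\<close> has multiplicity exactly \<open>n + 1\<close> in \<open>q - 1\<close>.
  The hypotheses on \<open>l\<close> give multiplicity \<open>N + 1\<close> in \<open>l - 1\<close>, and each of the \<open>n - N\<close> successive
  \<open>p\<close>-th powers raises it by one (\<open>multiplicity_iterated_power_prime_minus_one\<close>).
  Elements \<open>z\<close> of order \<open>p ^ (n + 1)\<close> exist because the multiplicative group is cyclic of order
  \<open>q - 1\<close>. The argument works for all \<open>n \<ge> N\<close>.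
\<close>

text \<open>
  Modulo \<open>p\<^sup>2\<close>, powers of \<open>x = 1 + p m\<close> are linear in the exponent, \<open>x ^ i = 1 + i p m\<close>, and the
  linear terms add up to \<open>p m\<close> times \<open>p (p - 1) / 2\<close>. For odd \<open>p\<close> the latter is a multiple of
  \<open>p\<close>, so only the constant terms survive.
\<close>

lemma geometric_sum_cong_square:
  fixes x :: int and p :: nat
  assumes "odd p" and "[x = 1] (mod int p)"
  shows "[(\<Sum>i<p. x ^ i) = int p] (mod (int p)\<^sup>2)"
proof -
  obtain m where x: "x = 1 + int p * m"
    using assms(2) by (metis cong_iff_lin cong_sym)
  have pow: "[x ^ i = 1 + int i * (int p * m)] (mod (int p)\<^sup>2)" for i
  proof (induction i)
    case (Suc i)
    have "[x * x ^ i = x * (1 + int i * (int p * m))] (mod (int p)\<^sup>2)"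
      using Suc by (rule cong_scalar_left)
    moreover have "x * (1 + int i * (int p * m))
        = 1 + int (Suc i) * (int p * m) + (int p)\<^sup>2 * (int i * m\<^sup>2)"
      by (simp add: x algebra_simps power2_eq_square)
    ultimately show ?case
      by (simp add: cong_def)
  qed simp
  obtain k where k: "p = 2 * k + 1"
    using assms(1) by (elim oddE)
  have "(\<Sum>i<p. int i) = int p * int k"
    unfolding k by (induction k) (simp_all add: algebra_simps)
  then have "(\<Sum>i<p. 1 + int i * (int p * m)) = int p + (int p)\<^sup>2 * (int k * m)"
    by (simp add: sum.distrib power2_eq_square flip: sum_distrib_right)
  moreover have "[(\<Sum>i<p. x ^ i) = (\<Sum>i<p. 1 + int i * (int p * m))] (mod (int p)\<^sup>2)"
    by (intro cong_sum pow)
  ultimately show ?thesis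
    by (simp add: cong_def)
qed

text \<open>
  In \<open>x ^ p - 1 = (x - 1) (1 + x + \<dots> + x ^ (p - 1))\<close> the second factor is \<open>p\<close> modulo \<open>p\<^sup>2\<close>,
  hence contributes exactly one factor \<open>p\<close>.
\<close>

lemma multiplicity_power_prime_minus_one:
  fixes x :: int and p :: nat
  assumes "prime p" and "odd p" and "[x = 1] (mod int p)" and "x ^ p \<noteq> 1"
  shows "multiplicity (int p) (x ^ p - 1) = Suc (multiplicity (int p) (x - 1))"
proof -
  let ?S = "\<Sum>i<p. x ^ i"
  have p: "prime_elem (int p)" "int p > 1"
    using assms(1) by (auto simp: prime_gt_Suc_0_nat)
  have fac: "x ^ p - 1 = (x - 1) * ?S"
    by (rule power_diff_1_eq)
  have S: "[?S = int p] (mod (int p)\<^sup>2)"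
    using assms(2,3) by (rule geometric_sum_cong_square)
  have "int p ^ 1 dvd ?S"
    using S by (metis cong_dvd_iff cong_dvd_modulus dvd_power dvd_refl pos2 power_one_right)
  moreover have "\<not> int p ^ Suc 1 dvd ?S"
  proof
    assume "int p ^ Suc 1 dvd ?S"
    then have "(int p)\<^sup>2 dvd int p"
      using cong_dvd_iff[OF S] by (simp add: power2_eq_square)
    then show False
      using p(2) zdvd_imp_le[of "(int p)\<^sup>2" "int p"] by (simp add: power2_eq_square)
  qed
  ultimately have "multiplicity (int p) ?S = 1"
    by (rule multiplicity_eqI)
  moreover have "x - 1 \<noteq> 0" "?S \<noteq> 0"
    using assms(4) fac by auto
  ultimately show ?thesis
    using p(1) by (simp add: fac prime_elem_multiplicity_mult_distrib)
qed

lemma multiplicity_iterated_power_prime_minus_one: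
  fixes x :: int and p :: nat
  assumes "prime p" and "odd p" and "[x = 1] (mod int p)" and "x > 1"
  shows "multiplicity (int p) (x ^ p ^ k - 1) = multiplicity (int p) (x - 1) + k"
proof (induction k)
  case (Suc k)
  have "[x ^ p ^ k = 1] (mod int p)"
    using cong_pow[OF assms(3)] by simp
  moreover have "1 < (x ^ p ^ k) ^ p"
    using assms(1,4) by (intro one_less_power) (simp_all add: prime_gt_0_nat)
  then have "(x ^ p ^ k) ^ p \<noteq> 1"
    by (metis less_irrefl)
  ultimately have "multiplicity (int p) ((x ^ p ^ k) ^ p - 1)
      = Suc (multiplicity (int p) (x ^ p ^ k - 1))"
    using assms(1,2) by (intro multiplicity_power_prime_minus_one)
  then show ?case
    using Suc by (simp add: mult.commute flip: power_mult)
qed simp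

lemma (in field) finite_field_exists_ord:
  assumes "finite (carrier R)" and "d dvd card (carrier R) - 1"
  shows "\<exists>z \<in> carrier (mult_of R). group.ord (mult_of R) z = d"
proof -
  interpret G: group "mult_of R"
    by (rule field_mult_group)
  have fin: "finite (carrier (mult_of R))"
    using assms(1) by (rule finite_mult_of)
  have card: "order (mult_of R) = card (carrier R) - 1"
    using order_mult_of[OF assms(1)] by (simp add: order_def)
  then have pos: "card (carrier R) - 1 > 0"
    using fin G.order_gt_0_iff_finite by simp
  obtain g where g: "g \<in> carrier (mult_of R)"
    and gen: "carrier (mult_of R) = {g [^] i | i::nat. i \<in> UNIV}"
    using finite_field_mult_group_has_gen[OF assms(1)] by blast
  have "generate (mult_of R) {g} = carrier (mult_of R)"
    using G.generate_pow_on_finite_carrier[OF fin g] gen by (simp add: nat_pow_mult_of)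
  then have ord_g: "G.ord g = card (carrier R) - 1"
    using G.generate_pow_card[OF g] card by (simp add: order_def)
  obtain k where k: "card (carrier R) - 1 = d * k"
    using assms(2) by blast
  then have "k \<noteq> 0"
    using pos by (metis mult_0_right less_irrefl)
  then have "G.ord (g [^]\<^bsub>mult_of R\<^esub> k) = d"
    using G.ord_pow[OF g, of k] ord_g k by simp
  then show ?thesis
    using G.nat_pow_closed[OF g] by blast
qed

text \<open>
  The identity \<open>1 - z = - z (1 - z\<inverse>)\<close> gives \<open>(- z) ^ M = 1\<close>; squaring removes the sign for every
  \<open>M\<close>, even or odd.
\<close>

lemma (in field) pow_eq_one_of_one_minus_and_one_minus_inv:
  fixes M :: nat
  assumes z: "z \<in> carrier R" "z \<noteq> \<zero>"
    and "(\<one> \<ominus> z) [^] M = \<one>" and "(\<one> \<ominus> inv z) [^] M = \<one>"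
  shows "z [^] (2 * M) = \<one>"
proof -
  have inv: "inv z \<in> carrier R" "z \<otimes> inv z = \<one>"
    using z field_Units by auto
  have "(\<ominus> z) \<otimes> (\<one> \<ominus> inv z) = \<one> \<ominus> z"
    using z inv by (simp add: minus_eq r_distr l_minus r_minus a_comm)
  then have "(\<ominus> z) [^] M \<otimes> (\<one> \<ominus> inv z) [^] M = (\<one> \<ominus> z) [^] M"
    using z inv by (simp flip: nat_pow_distrib)
  then have neg: "(\<ominus> z) [^] M = \<one>"
    using assms(3,4) z by simp
  have "z [^] (2 * M) = (z [^] (2::nat)) [^] M"
    using z by (simp add: nat_pow_pow)
  also have "z [^] (2::nat) = (\<ominus> z) [^] (2::nat)"
    using z by (simp add: numeral_2_eq_2 l_minus r_minus)
  also have "((\<ominus> z) [^] (2::nat)) [^] M = ((\<ominus> z) [^] M) [^] (2::nat)"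
    using z by (simp add: nat_pow_pow mult.commute)
  also have "\<dots> = \<one>"
    using neg by simp
  finally show ?thesis .
qed

text \<open>
  An element of order prime to \<open>p\<close> is killed by every \<open>M\<close> that differs from the group order
  by a power of \<open>p\<close> only. This turns a power different from \<open>1\<close> into divisibility of the order.
\<close>

lemma (in group) prime_dvd_ord_of_pow_neq_one:
  assumes "prime p" and "x \<in> carrier G" and "order G = p ^ e * M" and "x [^] M \<noteq> \<one>"
  shows "p dvd ord x"
proof (rule ccontr)
  assume "\<not> p dvd ord x"
  then have "coprime (ord x) (p ^ e)"
    using assms(1) by (metis coprime_commute coprime_power_right_iff prime_imp_coprime)
  moreover have "ord x dvd p ^ e * M"
    using ord_dvd_group_order[OF assms(2)] assms(3) by simp
  ultimately have "ord x dvd M"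
    by (simp add: coprime_dvd_mult_right_iff)
  then show False
    using assms(2,4) pow_eq_id by simp
qed

lemma (in field) exists_ord_prime_power_one_minus_pow_neq_one:
  assumes "finite (carrier R)" and "prime p" and "odd p" and "e > 0"
    and card: "card (carrier R) - 1 = p ^ e * M" and "\<not> p dvd M"
  shows "\<exists>z \<in> carrier (mult_of R).
           group.ord (mult_of R) z = p ^ e \<and>
           \<one> \<ominus> z \<in> carrier (mult_of R) \<and>
           p dvd group.ord (mult_of R) (\<one> \<ominus> z) \<and>
           (\<one> \<ominus> z) [^]\<^bsub>mult_of R\<^esub> M \<noteq> \<one>\<^bsub>mult_of R\<^esub>"
proof -
  interpret G: group "mult_of R"
    by (rule field_mult_group)
  obtain z where z: "z \<in> carrier (mult_of R)" and ord_z: "G.ord z = p ^ e"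
    using finite_field_exists_ord[OF assms(1), of "p ^ e"] card by auto
  have "\<not> p ^ e dvd 2 * M"
  proof
    assume "p ^ e dvd 2 * M"
    then have "p dvd 2 * M"
      using assms(4) by (meson dvd_power dvd_trans)
    then have "p dvd 2"
      using assms(2,6) prime_dvd_mult_iff by blast
    then have "p = 2"
      using assms(2) primes_dvd_imp_eq two_is_prime_nat by blast
    then show False
      using assms(3) by simp
  qed
  then have "z [^] (2 * M) \<noteq> \<one>"
    using G.pow_eq_id[OF z, of "2 * M"] ord_z by (simp add: nat_pow_mult_of)
  then have "(\<one> \<ominus> z) [^] M \<noteq> \<one> \<or> (\<one> \<ominus> inv z) [^] M \<noteq> \<one>"
    using pow_eq_one_of_one_minus_and_one_minus_inv[of z M] z by auto
  moreover have "inv z \<in> carrier (mult_of R)" "G.ord (inv z) = p ^ e"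
    using G.inv_closed[OF z] G.ord_inv[OF z] m_inv_mult_of[OF z] ord_z by auto
  ultimately obtain w where w: "w \<in> carrier (mult_of R)" and ord_w: "G.ord w = p ^ e"
    and pow_w: "(\<one> \<ominus> w) [^]\<^bsub>mult_of R\<^esub> M \<noteq> \<one>\<^bsub>mult_of R\<^esub>"
    using z ord_z by (auto simp: nat_pow_mult_of)
  have "w \<noteq> \<one>"
    using ord_w G.ord_id assms(4) one_less_power[OF prime_gt_1_nat[OF assms(2)], of e] by auto
  then have one_minus: "\<one> \<ominus> w \<in> carrier (mult_of R)"
    using w by simp
  moreover have "order (mult_of R) = p ^ e * M"
    using order_mult_of[OF assms(1)] card by (simp add: order_def)
  ultimately have "p dvd G.ord (\<one> \<ominus> w)"
    using assms(2) pow_w by (intro G.prime_dvd_ord_of_pow_neq_one)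
  then show ?thesis
    using w ord_w one_minus pow_w by blast
qed

theorem proposition4p1:
  fixes p l N :: nat
  assumes "prime p" and "odd p"
    and "prime l" and "odd l"
    and "[l = 1] (mod p ^ (N + 1))"
    and "\<not> [l = 1] (mod p ^ (N + 2))"
  shows "\<exists>n0\<ge>N. \<forall>n\<ge>n0. \<forall>K :: nat ring.
           finite_field_of_card K (l ^ (p ^ (n - N))) \<longrightarrow>
           (\<exists>z \<in> carrier (mult_of K).
              group.ord (mult_of K) z = p ^ (n + 1) \<and>
              \<one>\<^bsub>K\<^esub> \<ominus>\<^bsub>K\<^esub> z \<in> carrier (mult_of K) \<and>
              p dvd group.ord (mult_of K) (\<one>\<^bsub>K\<^esub> \<ominus>\<^bsub>K\<^esub> z) \<and>
              (\<one>\<^bsub>K\<^esub> \<ominus>\<^bsub>K\<^esub> z) [^]\<^bsub>mult_of K\<^esub> ((l ^ (p ^ (n - N)) - 1) div p ^ (n + 1)) \<noteq> \<one>\<^bsub>mult_of K\<^esub>)"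
proof (intro exI[of _ N] conjI allI impI)
  fix n and K :: "nat ring"
  assume n: "n \<ge> N" and K: "finite_field_of_card K (l ^ (p ^ (n - N)))"
  let ?q = "l ^ (p ^ (n - N))"
  define M where "M = (?q - 1) div p ^ (n + 1)"
  have l: "l > 1"
    using assms(3) by (rule prime_gt_1_nat)
  have cong_int: "[l = 1] (mod d) \<longleftrightarrow> int d dvd int l - 1" for d
    by (simp add: cong_iff_dvd_diff flip: cong_int_iff)
  have l_dvd: "int (p ^ (N + 1)) dvd int l - 1" "\<not> int (p ^ (N + 2)) dvd int l - 1"
    using assms(5,6) unfolding cong_int by blast+
  then have "multiplicity (int p) (int l - 1) = N + 1"
    by (intro multiplicity_eqI) simp_all
  moreover have "[int l = 1] (mod int p)"
    using l_dvd(1) by (auto simp: cong_iff_dvd_diff intro: dvd_mult_left)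
  ultimately have "multiplicity (int p) (int l ^ p ^ (n - N) - 1) = n + 1"
    using multiplicity_iterated_power_prime_minus_one[of p "int l" "n - N"] assms(1,2) l n by simp
  moreover have "int l ^ p ^ (n - N) - 1 = int (?q - 1)"
    using l by (simp add: of_nat_diff)
  ultimately have mult: "multiplicity (int p) (int (?q - 1)) = n + 1"
    by simp
  have "?q - 1 \<noteq> 0"
    using l one_less_power[of l "p ^ (n - N)"] assms(1) by (simp add: prime_gt_0_nat)
  have dvd: "p ^ (n + 1) dvd ?q - 1"
    using multiplicity_dvd[of "int p" "int (?q - 1)"] mult
    by (metis int_dvd_int_iff of_nat_power)
  then have card: "?q - 1 = p ^ (n + 1) * M"
    by (simp add: M_def)
  have "\<not> p dvd M"
  proof
    assume "p dvd M"
    then have "p ^ Suc (n + 1) dvd ?q - 1"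
      unfolding card by (simp add: mult_dvd_mono mult.commute)
    then have "int p ^ Suc (n + 1) dvd int (?q - 1)"
      by (metis int_dvd_int_iff of_nat_power)
    then have "Suc (n + 1) \<le> multiplicity (int p) (int (?q - 1))"
      using \<open>?q - 1 \<noteq> 0\<close> assms(1) unfolding of_nat_eq_0_iff[where 'a = int, symmetric]
      by (intro multiplicity_geI) (auto simp del: of_nat_diff)
    then show False
      using mult by simp
  qed
  then show "\<exists>z \<in> carrier (mult_of K).
              group.ord (mult_of K) z = p ^ (n + 1) \<and>
              \<one>\<^bsub>K\<^esub> \<ominus>\<^bsub>K\<^esub> z \<in> carrier (mult_of K) \<and>
              p dvd group.ord (mult_of K) (\<one>\<^bsub>K\<^esub> \<ominus>\<^bsub>K\<^esub> z) \<and>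
              (\<one>\<^bsub>K\<^esub> \<ominus>\<^bsub>K\<^esub> z) [^]\<^bsub>mult_of K\<^esub> ((?q - 1) div p ^ (n + 1)) \<noteq> \<one>\<^bsub>mult_of K\<^esub>"
    using field.exists_ord_prime_power_one_minus_pow_neq_one[of K p "n + 1" M] K card assms(1,2)
    unfolding finite_field_of_card_def by (simp flip: M_def)
qed simp

end
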